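(* (1) Let $(X,S)$ and $(X',S')$ be non-degenerate, involutive and braided set-theoretical solutions, with $X,X'$ finite. Assume $(X,S)$ and $(X',S')$ are isomorphic. Then their structure groups (respectively, the monoids with the same presentations) are t-isomorphic tableau groups (respectively, monoids). (2) Conversely, let $\operatorname{Mon}\langle X\mid R\rangle$ and $\operatorname{Mon}\langle X'\mid R'\rangle$ be t-isomorphic tableau Garside monoids, with $X,X'$ finite and non-empty, each satisfying the following two conditions (stated for $X,R$): the number of relations in $R$ is $n(n-1)/2$, where $n$ is the cardinality of $X$, and each side of a relation has length $2$; and if a word $x_ix_j$ appears in $R$, then it appears only once. Then the solutions $(X,S)$ and $(X',S')$ defined respectively by $\operatorname{Mon}\langle X\mid R\rangle$ and $\operatorname{Mon}\langle X'\mid R'\rangle$ are isomorphic.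
   Context: Set-theoretical solutions. A set-theoretical solution is a pair $(X,S)$ with $X$ a non-empty set and $S:X^2\to X^2$ a bijection; write $S(x,y)=(S_1(x,y),S_2(x,y))$. It is non-degenerate if for all fixed $y,z\in X$ the maps $x\mapsto S_2(x,y)$ and $x\mapsto S_1(z,x)$ are bijections; involutive if $S^2=\mathrm{id}_{X^2}$; braided if $S^{12}S^{23}S^{12}=S^{23}S^{12}S^{23}$ on $X^3$, where $S^{12}=S\times \mathrm{id}_X$ and $S^{23}=\mathrm{id}_X\times S$. The structure group (monoid) of $(X,S)$ is presented by generators $X$ and relations $xy=tz$ whenever $S(x,y)=(t,z)$. Solutions $(X,S)$ and $(X',S')$ are isomorphic if there is a bijection $\phi:X\to X'$ with $S'(\phi(x),\phi(y))=(\phi(S_1(x,y)),\phi(S_2(x,y)))$ for all $x,y\in X$. Tableau monoids. A tableau monoid is a monoid $\operatorname{Mon}\langle X\mid R\rangle$ (given by its presentation) such that each side of every relation in $R$ has length $2$. Two tableau monoids $\operatorname{Mon}\langle X\mid R\rangle$ and $\operatorname{Mon}\langle X'\mid R'\rangle$ are t-isomorphic if there is a bijection $s:X\to X'$ such that $x_ix_j=x_kx_l$ is a relation in $R$ if and only if $s(x_i)s(x_j)=s(x_k)s(x_l)$ is a relation in $R'$ (relations are regarded as unordered equalities). The same terminology is used for groups given by such presentations. Solution defined by a presentation. Given $\operatorname{Mon}\langle X\mid R\rangle$ satisfying the two conditions in (2) and Garside, the solution $(X,S)$ it defines is: if $x_ix_j=x_kx_l$ is a relation in $R$, then $S(x_i,x_j)=(x_k,x_l)$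 and $S(x_k,x_l)=(x_i,x_j)$; if the word $x_ix_j$ is not a side of any relation, then $S(x_i,x_j)=(x_i,x_j)$. Garside monoid. A monoid is Garside if it is atomic (generated by its atoms, with the lengths of decompositions of each element into atoms bounded), left and right cancellative, any two elements have left and right gcds and lcms, and it contains a Garside element, i.e. an element whose left divisors coincide with its right divisors, are finite in number, and generate the monoid. *)

theory Defs
  imports "HOL-Algebra.Divisibility" "HOL-Library.Uprod"
begin

section \<open>Set-theoretical solutions\<close>

definition set_solution :: "'a set \<Rightarrow> ('a \<times> 'a \<Rightarrow> 'a \<times> 'a) \<Rightarrow> bool" where
  "set_solution X S \<longleftrightarrow> X \<noteq> {} \<and> bij_betw S (X \<times> X) (X \<times> X)"

definition nondegenerate :: "'a set \<Rightarrow> ('a \<times> 'a \<Rightarrow> 'a \<times> 'a) \<Rightarrow> bool" where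
  "nondegenerate X S \<longleftrightarrow>
     (\<forall>y\<in>X. bij_betw (\<lambda>x. snd (S (x, y))) X X) \<and>
     (\<forall>z\<in>X. bij_betw (\<lambda>x. fst (S (z, x))) X X)"

definition involutive :: "'a set \<Rightarrow> ('a \<times> 'a \<Rightarrow> 'a \<times> 'a) \<Rightarrow> bool" where
  "involutive X S \<longleftrightarrow> (\<forall>p\<in>X \<times> X. S (S p) = p)"

definition S12 :: "('a \<times> 'a \<Rightarrow> 'a \<times> 'a) \<Rightarrow> 'a \<times> 'a \<times> 'a \<Rightarrow> 'a \<times> 'a \<times> 'a" where
  "S12 S = (\<lambda>(x, y, z). (fst (S (x, y)), snd (S (x, y)), z))"

definition S23 :: "('a \<times> 'a \<Rightarrow> 'a \<times> 'a) \<Rightarrow> 'a \<times> 'a \<times> 'a \<Rightarrow> 'a \<times> 'a \<times> 'a" where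
  "S23 S = (\<lambda>(x, y, z). (x, S (y, z)))"

definition braided :: "'a set \<Rightarrow> ('a \<times> 'a \<Rightarrow> 'a \<times> 'a) \<Rightarrow> bool" where
  "braided X S \<longleftrightarrow>
     (\<forall>p\<in>X \<times> X \<times> X. S12 S (S23 S (S12 S p)) = S23 S (S12 S (S23 S p)))"

definition solutions_isomorphic ::
  "'a set \<Rightarrow> ('a \<times> 'a \<Rightarrow> 'a \<times> 'a) \<Rightarrow> 'b set \<Rightarrow> ('b \<times> 'b \<Rightarrow> 'b \<times> 'b) \<Rightarrow> bool" where
  "solutions_isomorphic X S X' S' \<longleftrightarrow>
     set_solution X S \<and> set_solution X' S' \<and>
     (\<exists>\<phi>. bij_betw \<phi> X X' \<and>
       (\<forall>x\<in>X. \<forall>y\<in>X. S' (\<phi> x, \<phi> y) = (\<phi> (fst (S (x, y))), \<phi> (snd (S (x, y))))))"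


section \<open>Presented monoids and groups\<close>

text \<open>A relation \<open>u = v\<close> is the unordered pair \<open>Upair u v\<close> of words, so that
  \<open>u = v\<close> and \<open>v = u\<close> are one and the same relation.\<close>

inductive_set word_cong :: "'x set \<Rightarrow> 'x list uprod set \<Rightarrow> ('x list \<times> 'x list) set"
  for X :: "'x set" and R :: "'x list uprod set" where
  rel: "Upair u v \<in> R \<Longrightarrow> u \<in> lists X \<Longrightarrow> v \<in> lists X \<Longrightarrow> p \<in> lists X \<Longrightarrow> q \<in> lists X
          \<Longrightarrow> (p @ u @ q, p @ v @ q) \<in> word_cong X R"
| refl: "w \<in> lists X \<Longrightarrow> (w, w) \<in> word_cong X R"
| sym: "(w, w') \<in> word_cong X R \<Longrightarrow> (w', w) \<in> word_cong X R"
| trans: "(w, w') \<in> word_cong X R \<Longrightarrow> (w', w'') \<in> word_cong X R \<Longrightarrow> (w, w'') \<in> word_cong X R"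

text \<open>The record remembers the presentation along with the structure it presents:
  tableau conditions and t-isomorphism depend on the presentation, the Garside property
  on the underlying monoid.\<close>

record ('g, 'x) presented = "'g monoid" +
  generators :: "'x set"
  relations :: "'x list uprod set"

definition Mon :: "'x set \<Rightarrow> 'x list uprod set \<Rightarrow> ('x list set, 'x) presented" where
  "Mon X R =
     \<lparr> carrier = lists X // word_cong X R,
       mult = (\<lambda>A B. \<Union>a\<in>A. \<Union>b\<in>B. word_cong X R `` {a @ b}),
       one = word_cong X R `` {[]},
       generators = X,
       relations = R \<rparr>"

text \<open>The group presented by generators \<open>X\<close> and relations \<open>R\<close> between positive words: the letter
  \<open>(x, True)\<close> stands for the generator \<open>x\<close> and \<open>(x, False)\<close> for its formal inverse.\<close>

definition signed_relations ::
  "'x set \<Rightarrow> 'x list uprod set \<Rightarrow> ('x \<times> bool) list uprod set" where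
  "signed_relations X R =
     map_uprod (map (\<lambda>x. (x, True))) ` R \<union>
     {Upair [(x, b), (x, \<not> b)] [] | x b. x \<in> X}"

definition Grp :: "'x set \<Rightarrow> 'x list uprod set \<Rightarrow> (('x \<times> bool) list set, 'x) presented" where
  "Grp X R =
     (let M = Mon (X \<times> UNIV) (signed_relations X R) in
     \<lparr> carrier = carrier M, mult = mult M, one = one M, generators = X, relations = R \<rparr>)"

lemma word_cong_lists:
  "(w, w') \<in> word_cong X R \<Longrightarrow> w \<in> lists X \<and> w' \<in> lists X"
  by (induction rule: word_cong.induct) auto

lemma equiv_word_cong: "equiv (lists X) (word_cong X R)"
proof (rule equivI)
  show "word_cong X R \<subseteq> lists X \<times> lists X"
    using word_cong_lists by fast
  show "refl_on (lists X) (word_cong X R)"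
    by (rule refl_onI) (rule word_cong.refl)
  show "sym (word_cong X R)" by (rule symI) (rule word_cong.sym)
  show "trans (word_cong X R)" by (rule transI) (rule word_cong.trans)
qed

lemma word_cong_append_left:
  "(w, w') \<in> word_cong X R \<Longrightarrow> p \<in> lists X \<Longrightarrow> (p @ w, p @ w') \<in> word_cong X R"
proof (induction rule: word_cong.induct)
  case (rel u v p' q)
  then show ?case using word_cong.rel[of u v R X "p @ p'" q] by simp
next
  case (refl w)
  then show ?case by (intro word_cong.refl) simp
next
  case (sym w w')
  then show ?case by (simp only: word_cong.sym)
next
  case (trans w w' w'')
  then show ?case using word_cong.trans by metis
qed

lemma word_cong_append_right:
  "(w, w') \<in> word_cong X R \<Longrightarrow> q \<in> lists X \<Longrightarrow> (w @ q, w' @ q) \<in> word_cong X R"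
proof (induction rule: word_cong.induct)
  case (rel u v p q')
  then show ?case using word_cong.rel[of u v R X p "q' @ q"] by simp
next
  case (refl w)
  then show ?case by (intro word_cong.refl) simp
next
  case (sym w w')
  then show ?case by (simp only: word_cong.sym)
next
  case (trans w w' w'')
  then show ?case using word_cong.trans by metis
qed

lemma word_cong_append:
  assumes "(u, u') \<in> word_cong X R" "(v, v') \<in> word_cong X R"
  shows "(u @ v, u' @ v') \<in> word_cong X R"
proof (rule word_cong.trans)
  show "(u @ v, u' @ v) \<in> word_cong X R"
    using word_cong_append_right[OF assms(1)] word_cong_lists[OF assms(2)] by simp
  show "(u' @ v, u' @ v') \<in> word_cong X R"
    using word_cong_append_left[OF assms(2)] word_cong_lists[OF assms(1)] by simp
qed

lemma Mon_mult_class: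
  assumes "u \<in> lists X" "v \<in> lists X"
  shows "word_cong X R `` {u} \<otimes>\<^bsub>Mon X R\<^esub> word_cong X R `` {v} = word_cong X R `` {u @ v}"
proof -
  have *: "word_cong X R `` {a @ b} = word_cong X R `` {u @ v}"
    if "a \<in> word_cong X R `` {u}" "b \<in> word_cong X R `` {v}" for a b
    using that equiv_class_eq[OF equiv_word_cong word_cong_append[of u a X R v b]] by simp
  have ne: "word_cong X R `` {u} \<noteq> {}" "word_cong X R `` {v} \<noteq> {}"
    using word_cong.refl[OF assms(1)] word_cong.refl[OF assms(2)] by fast+
  have "word_cong X R `` {u} \<otimes>\<^bsub>Mon X R\<^esub> word_cong X R `` {v} =
      (\<Union>a\<in>word_cong X R `` {u}. \<Union>b\<in>word_cong X R `` {v}. word_cong X R `` {a @ b})"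
    by (simp add: Mon_def)
  also have "\<dots> = (\<Union>a\<in>word_cong X R `` {u}. \<Union>b\<in>word_cong X R `` {v}. word_cong X R `` {u @ v})"
    by (intro SUP_cong) (simp_all only: *)
  finally show ?thesis using ne by simp
qed

lemma Mon_carrierE:
  assumes "A \<in> carrier (Mon X R)"
  obtains w where "w \<in> lists X" "A = word_cong X R `` {w}"
  using assms by (auto simp: Mon_def quotient_def)

lemma Mon_class_carrier: "w \<in> lists X \<Longrightarrow> word_cong X R `` {w} \<in> carrier (Mon X R)"
  by (auto simp: Mon_def quotient_def)

lemma Mon_one: "\<one>\<^bsub>Mon X R\<^esub> = word_cong X R `` {[]}"
  by (simp add: Mon_def)

lemma monoid_Mon: "monoid (Mon X R)"
proof (rule monoidI)
  fix A B
  assume "A \<in> carrier (Mon X R)" "B \<in> carrier (Mon X R)"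
  then obtain a b where "a \<in> lists X" "A = word_cong X R `` {a}"
    "b \<in> lists X" "B = word_cong X R `` {b}"
    by (elim Mon_carrierE)
  then show "A \<otimes>\<^bsub>Mon X R\<^esub> B \<in> carrier (Mon X R)"
    using Mon_mult_class[of a X b R] Mon_class_carrier[of "a @ b" X R] by simp
next
  show "\<one>\<^bsub>Mon X R\<^esub> \<in> carrier (Mon X R)"
    using Mon_class_carrier[of "[]" X R] by (simp add: Mon_one)
next
  fix A B C
  assume "A \<in> carrier (Mon X R)" "B \<in> carrier (Mon X R)" "C \<in> carrier (Mon X R)"
  then obtain a b c where *: "a \<in> lists X" "A = word_cong X R `` {a}"
    "b \<in> lists X" "B = word_cong X R `` {b}" "c \<in> lists X" "C = word_cong X R `` {c}"
    by (elim Mon_carrierE)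
  then have "a @ b \<in> lists X" "b @ c \<in> lists X" by simp_all
  then show "A \<otimes>\<^bsub>Mon X R\<^esub> B \<otimes>\<^bsub>Mon X R\<^esub> C = A \<otimes>\<^bsub>Mon X R\<^esub> (B \<otimes>\<^bsub>Mon X R\<^esub> C)"
    using * by (simp only: Mon_mult_class append_assoc)
next
  fix A assume "A \<in> carrier (Mon X R)"
  then obtain a where a: "a \<in> lists X" "A = word_cong X R `` {a}" by (rule Mon_carrierE)
  show "\<one>\<^bsub>Mon X R\<^esub> \<otimes>\<^bsub>Mon X R\<^esub> A = A" "A \<otimes>\<^bsub>Mon X R\<^esub> \<one>\<^bsub>Mon X R\<^esub> = A"
    using Mon_mult_class[of "[]" X a R] Mon_mult_class[of a X "[]" R] a by (simp_all add: Mon_one)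
qed

lemma group_Grp: "group (Grp X R)"
proof -
  define Q where "Q = signed_relations X R"
  define Y where "Y = X \<times> (UNIV :: bool set)"
  interpret M: monoid "Mon Y Q" by (rule monoid_Mon)
  define inv_word where "inv_word = (\<lambda>w :: ('a \<times> bool) list. rev (map (\<lambda>(x, b). (x, \<not> b)) w))"
  have iw: "inv_word w \<in> lists Y" if "w \<in> lists Y" for w
    using that by (auto simp: inv_word_def Y_def)
  have canc: "(inv_word w @ w, []) \<in> word_cong Y Q" if "w \<in> lists Y" for w
    using that
  proof (induction w)
    case (Cons l w)
    obtain x b where l: "l = (x, b)" "x \<in> X" using Cons by (cases l) (auto simp: Y_def)
    have "Upair [(x, \<not> b), (x, b)] [] \<in> Q"
      unfolding Q_def signed_relations_def using l(2) by force
    from word_cong.rel[OF this, of Y "inv_word w" w]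
    have "(inv_word (l # w) @ l # w, inv_word w @ w) \<in> word_cong Y Q"
      using l iw[of w] Cons.hyps by (simp add: inv_word_def Y_def)
    moreover have "(inv_word w @ w, []) \<in> word_cong Y Q" using Cons by auto
    ultimately show ?case by (rule word_cong.trans)
  qed (auto simp: inv_word_def intro: word_cong.refl)
  have "group (Mon Y Q)"
  proof (rule M.group_l_invI)
    fix A assume "A \<in> carrier (Mon Y Q)"
    then obtain w where w: "w \<in> lists Y" "A = word_cong Y Q `` {w}" by (rule Mon_carrierE)
    then have "word_cong Y Q `` {inv_word w} \<otimes>\<^bsub>Mon Y Q\<^esub> A = \<one>\<^bsub>Mon Y Q\<^esub>"
      using equiv_class_eq[OF equiv_word_cong canc[OF w(1)]]
      by (simp add: Mon_mult_class[OF iw[OF w(1)] w(1)] Mon_one)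
    then show "\<exists>B\<in>carrier (Mon Y Q). B \<otimes>\<^bsub>Mon Y Q\<^esub> A = \<one>\<^bsub>Mon Y Q\<^esub>"
      using Mon_class_carrier[OF iw[OF w(1)]] by blast
  qed
  then interpret G: group "Mon Y Q" .
  have eqs: "carrier (Grp X R) = carrier (Mon Y Q)" "mult (Grp X R) = mult (Mon Y Q)"
    "one (Grp X R) = one (Mon Y Q)"
    by (simp_all add: Grp_def Let_def Q_def Y_def)
  show ?thesis
    by (rule groupI; unfold eqs) (auto simp: M.m_assoc intro: G.l_inv_ex)
qed


section \<open>Tableau monoids and groups\<close>

definition tableau_relations :: "'x set \<Rightarrow> 'x list uprod set \<Rightarrow> bool" where
  "tableau_relations X R \<longleftrightarrow> (\<forall>r\<in>R. \<forall>w\<in>set_uprod r. w \<in> lists X \<and> length w = 2)"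

definition tableau_monoid :: "('x list set, 'x) presented \<Rightarrow> bool" where
  "tableau_monoid M \<longleftrightarrow>
     M = Mon (generators M) (relations M) \<and> tableau_relations (generators M) (relations M)"

definition tableau_group :: "(('x \<times> bool) list set, 'x) presented \<Rightarrow> bool" where
  "tableau_group G \<longleftrightarrow>
     G = Grp (generators G) (relations G) \<and> tableau_relations (generators G) (relations G)"

definition t_isomorphic :: "('g, 'x) presented \<Rightarrow> ('h, 'y) presented \<Rightarrow> bool" where
  "t_isomorphic M M' \<longleftrightarrow>
     (\<exists>s. bij_betw s (generators M) (generators M') \<and>
       (\<forall>i\<in>generators M. \<forall>j\<in>generators M. \<forall>k\<in>generators M. \<forall>l\<in>generators M.
          Upair [i, j] [k, l] \<in> relations M \<longleftrightarrow>
          Upair [s i, s j] [s k, s l] \<in> relations M'))"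

definition structure_relations :: "'a set \<Rightarrow> ('a \<times> 'a \<Rightarrow> 'a \<times> 'a) \<Rightarrow> 'a list uprod set" where
  "structure_relations X S = {Upair [x, y] [t, z] | x y t z. x \<in> X \<and> y \<in> X \<and> S (x, y) = (t, z)}"

definition structure_monoid ::
  "'a set \<Rightarrow> ('a \<times> 'a \<Rightarrow> 'a \<times> 'a) \<Rightarrow> ('a list set, 'a) presented" where
  "structure_monoid X S = Mon X (structure_relations X S)"

definition structure_group ::
  "'a set \<Rightarrow> ('a \<times> 'a \<Rightarrow> 'a \<times> 'a) \<Rightarrow> (('a \<times> bool) list set, 'a) presented" where
  "structure_group X S = Grp X (structure_relations X S)"


section \<open>Garside monoids\<close>

definition opposite :: "('g, 'm) monoid_scheme \<Rightarrow> ('g, 'm) monoid_scheme" where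
  "opposite G = G\<lparr>mult := (\<lambda>x y. y \<otimes>\<^bsub>G\<^esub> x)\<rparr>"

definition atoms :: "('g, 'm) monoid_scheme \<Rightarrow> 'g set" where
  "atoms G = {a \<in> carrier G. a \<noteq> \<one>\<^bsub>G\<^esub> \<and>
     (\<forall>b\<in>carrier G. \<forall>c\<in>carrier G. a = b \<otimes>\<^bsub>G\<^esub> c \<longrightarrow> b = \<one>\<^bsub>G\<^esub> \<or> c = \<one>\<^bsub>G\<^esub>)}"

definition monoid_generated_by :: "('g, 'm) monoid_scheme \<Rightarrow> 'g set \<Rightarrow> bool" where
  "monoid_generated_by G A \<longleftrightarrow>
     A \<subseteq> carrier G \<and> (\<forall>x\<in>carrier G. \<exists>as\<in>lists A. foldr (\<otimes>\<^bsub>G\<^esub>) as \<one>\<^bsub>G\<^esub> = x)"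

definition atomic_monoid :: "('g, 'm) monoid_scheme \<Rightarrow> bool" where
  "atomic_monoid G \<longleftrightarrow>
     monoid_generated_by G (atoms G) \<and>
     (\<forall>x\<in>carrier G. \<exists>N::nat. \<forall>as\<in>lists (atoms G).
        foldr (\<otimes>\<^bsub>G\<^esub>) as \<one>\<^bsub>G\<^esub> = x \<longrightarrow> length as \<le> N)"

text \<open>The library relation \<open>a divides\<^bsub>G\<^esub> b\<close> means \<open>b = a c\<close> for some \<open>c\<close>, which is left
  divisibility when \<open>G\<close> is not commutative; right divisibility is left divisibility in the
  opposite monoid. Hence \<open>gcdof\<^bsub>G\<^esub>\<close> and \<open>lcmof\<^bsub>G\<^esub>\<close> are a left gcd and a right lcm, and
  the same notions in the opposite monoid are a right gcd and a left lcm.\<close>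

definition left_divisors :: "('g, 'm) monoid_scheme \<Rightarrow> 'g \<Rightarrow> 'g set" where
  "left_divisors G b = {a \<in> carrier G. a divides\<^bsub>G\<^esub> b}"

definition right_divisors :: "('g, 'm) monoid_scheme \<Rightarrow> 'g \<Rightarrow> 'g set" where
  "right_divisors G b = {a \<in> carrier G. a divides\<^bsub>opposite G\<^esub> b}"

definition garside_element :: "('g, 'm) monoid_scheme \<Rightarrow> 'g \<Rightarrow> bool" where
  "garside_element G \<Delta> \<longleftrightarrow>
     \<Delta> \<in> carrier G \<and>
     left_divisors G \<Delta> = right_divisors G \<Delta> \<and>
     finite (left_divisors G \<Delta>) \<and>
     monoid_generated_by G (left_divisors G \<Delta>)"

definition garside_monoid :: "('g, 'm) monoid_scheme \<Rightarrow> bool" where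
  "garside_monoid G \<longleftrightarrow>
     monoid_cancel G \<and>
     atomic_monoid G \<and>
     (\<forall>a\<in>carrier G. \<forall>b\<in>carrier G.
        (\<exists>x\<in>carrier G. x gcdof\<^bsub>G\<^esub> a b) \<and>
        (\<exists>x\<in>carrier G. x lcmof\<^bsub>G\<^esub> a b) \<and>
        (\<exists>x\<in>carrier G. x gcdof\<^bsub>opposite G\<^esub> a b) \<and>
        (\<exists>x\<in>carrier G. x lcmof\<^bsub>opposite G\<^esub> a b)) \<and>
     (\<exists>\<Delta>. garside_element G \<Delta>)"


section \<open>The solution defined by a presentation\<close>

text \<open>No word occurs twice in the list of all sides of relations in \<open>R\<close>. In a relation \<open>u = u\<close>
  the word \<open>u\<close> would occur twice.\<close>

definition words_appear_once :: "'x list uprod set \<Rightarrow> bool" where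
  "words_appear_once R \<longleftrightarrow>
     (\<forall>u. Upair u u \<notin> R) \<and>
     (\<forall>r\<in>R. \<forall>r'\<in>R. \<forall>w. w \<in> set_uprod r \<and> w \<in> set_uprod r' \<longrightarrow> r = r')"

definition presentation_conditions :: "'x set \<Rightarrow> 'x list uprod set \<Rightarrow> bool" where
  "presentation_conditions X R \<longleftrightarrow>
     finite R \<and> card R = card X * (card X - 1) div 2 \<and>
     (\<forall>r\<in>R. \<forall>w\<in>set_uprod r. length w = 2) \<and>
     words_appear_once R"

text \<open>The partner \<open>(k, l)\<close> of \<open>(i, j)\<close> is unique as soon as \<open>words_appear_once R\<close> holds, which is
  the only situation in which this definition is meant to be used.\<close>

definition defined_solution :: "'x list uprod set \<Rightarrow> 'x \<times> 'x \<Rightarrow> 'x \<times> 'x" where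
  "defined_solution R = (\<lambda>(i, j).
     if \<exists>k l. Upair [i, j] [k, l] \<in> R
     then (THE (k, l). Upair [i, j] [k, l] \<in> R)
     else (i, j))"

lemma defined_solution_eq:
  assumes "words_appear_once R" "Upair [i, j] [k, l] \<in> R"
  shows "defined_solution R (i, j) = (k, l)" "defined_solution R (k, l) = (i, j)"
proof -
  have *: "defined_solution R (i, j) = (k, l)" if kl: "Upair [i, j] [k, l] \<in> R" for i j k l
  proof -
    have "p = (k, l)" if p: "Upair [i, j] [fst p, snd p] \<in> R" for p
    proof -
      have "r = r'" if "r \<in> R" "r' \<in> R" "w \<in> set_uprod r" "w \<in> set_uprod r'" for r r' w
        using assms(1) that by (simp only: words_appear_once_def)
      from this[OF p kl, of "[i, j]"]
      have "Upair [i, j] [fst p, snd p] = Upair [i, j] [k, l]" by simp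
      then show ?thesis by (cases p) auto
    qed
    then have "(THE p. Upair [i, j] [fst p, snd p] \<in> R) = (k, l)"
      using kl by (intro the_equality) auto
    then show ?thesis
      using kl unfolding defined_solution_def case_prod_beta by (auto simp del: Upair_inject)
  qed
  show "defined_solution R (i, j) = (k, l)" by (rule *[OF assms(2)])
  have "Upair [k, l] [i, j] = Upair [i, j] [k, l]" by simp
  then show "defined_solution R (k, l) = (i, j)" using * assms(2) by metis
qed

end

theory Submission
  imports Defs
begin

text \<open>A solution and its quadratic relations determine each other. For a map \<open>S\<close> on pairs, the
  equality \<open>xy = tz\<close> is a structure relation exactly when \<open>S\<close> sends one side to the other
  (\<open>structure_relation_iff\<close>). A bijection that intertwines two such maps preserves and, being
  injective, also reflects these conditions. It is therefore a t-isomorphism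
  (\<open>intertwining_preserves_structure_relations\<close>), and since the presented monoid and the presented
  group carry the same relations, one bijection serves both.

  Conversely, when no word occurs twice, the relations pair up some of the words of length two, and
  the defined solution is the involution that exchanges paired words and fixes the others
  (\<open>defined_solution_involution\<close>); an involution is a bijection. A t-isomorphism carries pairs to
  pairs. It also carries unpaired words to unpaired words: a partner of \<open>s x s y\<close> consists of
  generators, hence is itself in the image of \<open>s\<close> and can be pulled back to a partner of \<open>x y\<close>. So
  it intertwines the two involutions (\<open>t_isomorphism_intertwines_defined_solutions\<close>).\<close>

lemma structure_relation_iff:
  "Upair [i, j] [k, l] \<in> structure_relations X S \<longleftrightarrow>
     (i \<in> X \<and> j \<in> X \<and> S (i, j) = (k, l)) \<or> (k \<in> X \<and> l \<in> X \<and> S (k, l) = (i, j))"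
  unfolding structure_relations_def by auto

lemma tableau_structure_relations:
  assumes "S ` (X \<times> X) \<subseteq> X \<times> X"
  shows "tableau_relations X (structure_relations X S)"
  using assms unfolding tableau_relations_def structure_relations_def by fastforce

lemma structure_group_simps:
  "generators (structure_group X S) = X"
  "relations (structure_group X S) = structure_relations X S"
  by (simp_all add: structure_group_def Grp_def Let_def)

lemma structure_monoid_simps:
  "generators (structure_monoid X S) = X"
  "relations (structure_monoid X S) = structure_relations X S"
  by (simp_all add: structure_monoid_def Mon_def)

text \<open>Injectivity of \<open>\<phi>\<close> makes \<open>S (i, j) = (k, l)\<close> equivalent to the same equation between the
  images; the unordered relation is the disjunction of two such equations.\<close>

lemma intertwining_preserves_structure_relations:
  assumes bij: "bij_betw \<phi> X X'"
    and maps: "S ` (X \<times> X) \<subseteq> X \<times> X"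
    and intertw: "\<And>x y. x \<in> X \<Longrightarrow> y \<in> X \<Longrightarrow>
      S' (\<phi> x, \<phi> y) = (\<phi> (fst (S (x, y))), \<phi> (snd (S (x, y))))"
    and ijkl: "i \<in> X" "j \<in> X" "k \<in> X" "l \<in> X"
  shows "Upair [i, j] [k, l] \<in> structure_relations X S \<longleftrightarrow>
    Upair [\<phi> i, \<phi> j] [\<phi> k, \<phi> l] \<in> structure_relations X' S'"
proof -
  have graph: "S' (\<phi> a, \<phi> b) = (\<phi> c, \<phi> d) \<longleftrightarrow> S (a, b) = (c, d)"
    if "a \<in> X" "b \<in> X" "c \<in> X" "d \<in> X" for a b c d
  proof -
    have "S (a, b) \<in> X \<times> X" using maps that by blast
    then have "fst (S (a, b)) \<in> X" "snd (S (a, b)) \<in> X"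
      by (simp_all add: mem_Times_iff)
    then show ?thesis
      using that intertw bij_betw_imp_inj_on[OF bij]
      by (simp add: inj_on_eq_iff prod_eq_iff)
  qed
  have "\<phi> x \<in> X'" if "x \<in> X" for x
    using bij_betwE[OF bij] that by blast
  then show ?thesis
    unfolding structure_relation_iff using ijkl graph by simp
qed

lemma defined_solution_fixed:
  "(\<And>k l. Upair [i, j] [k, l] \<notin> R) \<Longrightarrow> defined_solution R (i, j) = (i, j)"
  by (simp add: defined_solution_def)

lemma tableau_relation_generators:
  assumes "tableau_relations X R" "Upair [i, j] [k, l] \<in> R"
  shows "i \<in> X" "j \<in> X" "k \<in> X" "l \<in> X"
  using assms unfolding tableau_relations_def by fastforce+

lemma defined_solution_involution:
  assumes tab: "tableau_relations X R" and once: "words_appear_once R" and p: "p \<in> X \<times> X"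
  shows "defined_solution R p \<in> X \<times> X" "defined_solution R (defined_solution R p) = p"
proof -
  obtain i j where ij: "p = (i, j)" by (cases p)
  have "defined_solution R p \<in> X \<times> X \<and> defined_solution R (defined_solution R p) = p"
  proof (cases "\<exists>k l. Upair [i, j] [k, l] \<in> R")
    case True
    then obtain k l where kl: "Upair [i, j] [k, l] \<in> R" by blast
    then show ?thesis
      using tableau_relation_generators[OF tab kl] defined_solution_eq[OF once kl] ij by simp
  next
    case False
    then show ?thesis using defined_solution_fixed[of i j R] ij p by simp
  qed
  then show "defined_solution R p \<in> X \<times> X" "defined_solution R (defined_solution R p) = p"
    by simp_all
qed

lemma set_solution_defined_solution:
  assumes "X \<noteq> {}" "tableau_relations X R" "words_appear_once R"
  shows "set_solution X (defined_solution R)"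
  unfolding set_solution_def
proof
  show "bij_betw (defined_solution R) (X \<times> X) (X \<times> X)"
    using defined_solution_involution[OF assms(2,3)]
    by (intro bij_betw_byWitness[where f' = "defined_solution R"]; blast)
qed (fact assms(1))

text \<open>The relations of \<open>R'\<close> are known only on words over \<open>s ` X\<close>. Surjectivity of \<open>s\<close> onto \<open>X'\<close>
  together with \<open>tableau_relations X' R'\<close> ensures that there are no others, so a word that \<open>R\<close>
  leaves unpaired cannot acquire a partner in \<open>R'\<close>.\<close>

lemma t_isomorphism_intertwines_defined_solutions:
  assumes bij: "bij_betw s X X'"
    and tab: "tableau_relations X R" "tableau_relations X' R'"
    and once: "words_appear_once R" "words_appear_once R'"
    and rels: "\<And>i j k l. i \<in> X \<Longrightarrow> j \<in> X \<Longrightarrow> k \<in> X \<Longrightarrow> l \<in> X \<Longrightarrow>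
      Upair [i, j] [k, l] \<in> R \<longleftrightarrow> Upair [s i, s j] [s k, s l] \<in> R'"
    and xy: "x \<in> X" "y \<in> X"
  shows "defined_solution R' (s x, s y) =
    (s (fst (defined_solution R (x, y))), s (snd (defined_solution R (x, y))))"
proof (cases "\<exists>k l. Upair [x, y] [k, l] \<in> R")
  case True
  then obtain k l where kl: "Upair [x, y] [k, l] \<in> R" by blast
  then have "Upair [s x, s y] [s k, s l] \<in> R'"
    using rels xy tableau_relation_generators[OF tab(1) kl] by blast
  then show ?thesis
    using defined_solution_eq(1)[OF once(1) kl] defined_solution_eq(1)[OF once(2)] by simp
next
  case False
  have "Upair [s x, s y] [k', l'] \<notin> R'" for k' l'
  proof
    assume rel: "Upair [s x, s y] [k', l'] \<in> R'"
    then have "k' \<in> s ` X" "l' \<in> s ` X"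
      using tableau_relation_generators[OF tab(2) rel] bij_betw_imp_surj_on[OF bij] by auto
    then obtain k l where "k \<in> X" "l \<in> X" "k' = s k" "l' = s l" by blast
    then show False using rel rels xy False by blast
  qed
  then show ?thesis
    using False defined_solution_fixed[of x y R] defined_solution_fixed[of "s x" "s y" R'] by simp
qed

lemma tableau_group_structure_group:
  assumes "set_solution X S"
  shows "tableau_group (structure_group X S)"
  using assms tableau_structure_relations[of S X]
  by (simp add: tableau_group_def structure_group_simps)
    (simp add: structure_group_def set_solution_def bij_betw_def)

lemma tableau_monoid_structure_monoid:
  assumes "set_solution X S"
  shows "tableau_monoid (structure_monoid X S)"
  using assms tableau_structure_relations[of S X]
  by (simp add: tableau_monoid_def structure_monoid_simps)
    (simp add: structure_monoid_def set_solution_def bij_betw_def)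

lemma t_isomorphic_if_solutions_isomorphic:
  assumes "solutions_isomorphic X S X' S'"
  shows "t_isomorphic (structure_group X S) (structure_group X' S')"
    and "t_isomorphic (structure_monoid X S) (structure_monoid X' S')"
proof -
  obtain \<phi> where bij: "bij_betw \<phi> X X'"
    and intertw: "\<And>x y. x \<in> X \<Longrightarrow> y \<in> X \<Longrightarrow>
      S' (\<phi> x, \<phi> y) = (\<phi> (fst (S (x, y))), \<phi> (snd (S (x, y))))"
    using assms unfolding solutions_isomorphic_def by blast
  have maps: "S ` (X \<times> X) \<subseteq> X \<times> X"
    using assms by (auto simp: solutions_isomorphic_def set_solution_def bij_betw_def)
  note pres = intertwining_preserves_structure_relations[OF bij maps intertw]
  show "t_isomorphic (structure_group X S) (structure_group X' S')"
    unfolding t_isomorphic_def structure_group_simps using bij pres by blast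
  show "t_isomorphic (structure_monoid X S) (structure_monoid X' S')"
    unfolding t_isomorphic_def structure_monoid_simps using bij pres by blast
qed

lemma solutions_isomorphic_if_t_isomorphic:
  assumes ne: "X \<noteq> {}" "X' \<noteq> {}"
    and tab: "tableau_relations X R" "tableau_relations X' R'"
    and once: "words_appear_once R" "words_appear_once R'"
    and iso: "t_isomorphic (Mon X R) (Mon X' R')"
  shows "solutions_isomorphic X (defined_solution R) X' (defined_solution R')"
proof -
  obtain s where bij: "bij_betw s X X'"
    and rels: "\<And>i j k l. i \<in> X \<Longrightarrow> j \<in> X \<Longrightarrow> k \<in> X \<Longrightarrow> l \<in> X \<Longrightarrow>
      Upair [i, j] [k, l] \<in> R \<longleftrightarrow> Upair [s i, s j] [s k, s l] \<in> R'"
    using iso unfolding t_isomorphic_def by (auto simp: Mon_def)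
  show ?thesis
    unfolding solutions_isomorphic_def
    using set_solution_defined_solution[OF ne(1) tab(1) once(1)]
      set_solution_defined_solution[OF ne(2) tab(2) once(2)] bij
      t_isomorphism_intertwines_defined_solutions[OF bij tab once rels]
    by blast
qed

theorem proposition6p10:
  shows
    "(\<forall>(X :: 'a set) S (X' :: 'b set) S'.
        finite X \<and> finite X' \<and>
        set_solution X S \<and> nondegenerate X S \<and> involutive X S \<and> braided X S \<and>
        set_solution X' S' \<and> nondegenerate X' S' \<and> involutive X' S' \<and> braided X' S' \<and>
        solutions_isomorphic X S X' S' \<longrightarrow>
        (tableau_group (structure_group X S) \<and> tableau_group (structure_group X' S') \<and>
         t_isomorphic (structure_group X S) (structure_group X' S')) \<and>
        (tableau_monoid (structure_monoid X S) \<and> tableau_monoid (structure_monoid X' S') \<and>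
         t_isomorphic (structure_monoid X S) (structure_monoid X' S')))
     \<and>
     (\<forall>(X :: 'a set) R (X' :: 'b set) R'.
        finite X \<and> X \<noteq> {} \<and> finite X' \<and> X' \<noteq> {} \<and>
        tableau_monoid (Mon X R) \<and> tableau_monoid (Mon X' R') \<and>
        garside_monoid (Mon X R) \<and> garside_monoid (Mon X' R') \<and>
        presentation_conditions X R \<and> presentation_conditions X' R' \<and>
        t_isomorphic (Mon X R) (Mon X' R') \<longrightarrow>
        solutions_isomorphic X (defined_solution R) X' (defined_solution R'))"
proof (intro conjI allI impI; elim conjE)
  fix X :: "'a set" and S and X' :: "'b set" and S'
  assume sol: "set_solution X S" "set_solution X' S'" and iso: "solutions_isomorphic X S X' S'"
  show "tableau_group (structure_group X S)" "tableau_group (structure_group X' S')"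
    "tableau_monoid (structure_monoid X S)" "tableau_monoid (structure_monoid X' S')"
    using sol by (simp_all add: tableau_group_structure_group tableau_monoid_structure_monoid)
  show "t_isomorphic (structure_group X S) (structure_group X' S')"
    "t_isomorphic (structure_monoid X S) (structure_monoid X' S')"
    using t_isomorphic_if_solutions_isomorphic[OF iso] by simp_all
next
  fix X :: "'a set" and R and X' :: "'b set" and R'
  assume ne: "X \<noteq> {}" "X' \<noteq> {}"
    and tab: "tableau_monoid (Mon X R)" "tableau_monoid (Mon X' R')"
    and cond: "presentation_conditions X R" "presentation_conditions X' R'"
    and iso: "t_isomorphic (Mon X R) (Mon X' R')"
  have "tableau_relations X R" "tableau_relations X' R'"
    using tab by (simp_all add: tableau_monoid_def Mon_def)
  moreover have "words_appear_once R" "words_appear_once R'"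
    using cond by (simp_all add: presentation_conditions_def)
  ultimately show "solutions_isomorphic X (defined_solution R) X' (defined_solution R')"
    using ne iso by (intro solutions_isomorphic_if_t_isomorphic)
qed

end
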